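(* For every odd integer $t\geq 1$ and every integer $n\geq 0$, $$\overline{p}_{-t}(n)\equiv\begin{cases}1\pmod 4 & \text{if } n=0,\\ 2\pmod 4 & \text{if } n \text{ is a positive perfect square},\\ 0 \pmod 4 & \text{otherwise}.\end{cases}$$
   Context: For a positive integer $r$, let $f_r=\prod_{m\geq 1}(1-q^{rm})$. For a positive integer $t$, $\overline{p}_{-t}(n)$ (the number of $t$-colored overpartitions of $n$) is defined by $\sum_{n\geq 0}\overline{p}_{-t}(n)q^n=\left(f_2/f_1^{2}\right)^t$. *)

theory Defs
  imports
    "HOL-Analysis.Analysis"
    "HOL-Computational_Algebra.Computational_Algebra"
    "HOL-Number_Theory.Number_Theory"
begin

text \<open>The index is shifted: factor \<open>m\<close> of \<open>prodinf\<close> is the factor \<open>m + 1\<close> of the product.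
  Convergence is with respect to the library's topology on formal power series. For \<open>r = 0\<close>
  the value is unspecified.\<close>

definition euler_prod :: "nat \<Rightarrow> int fps" where
  "euler_prod r = (\<Prod>m. 1 - fps_X ^ (r * Suc m))"

text \<open>The type \<open>int\<close> has no \<open>inverse\<close>, so the quotient is formed with the library's one-sided
  inverse, whose second argument is the inverse of the constant coefficient. By
  \<open>colored_overpartitions_gf\<close> below, this is the quotient in the ring of integer power series.\<close>

definition colored_overpartitions_gf :: "nat \<Rightarrow> int fps" where
  "colored_overpartitions_gf t = (euler_prod 2 * fps_right_inverse (euler_prod 1 ^ 2) 1) ^ t"

definition colored_overpartitions :: "nat \<Rightarrow> nat \<Rightarrow> int" where
  "colored_overpartitions t n = fps_nth (colored_overpartitions_gf t) n"

lemma fps_nth_euler_partial: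
  assumes "r > 0" "n \<le> k"
  shows "fps_nth (\<Prod>m\<le>k. 1 - fps_X ^ (r * Suc m) :: int fps) n =
         fps_nth (\<Prod>m\<le>n. 1 - fps_X ^ (r * Suc m)) n"
  using assms(2)
proof (induction k rule: dec_induct)
  case (step k)
  have "n < r * Suc (Suc k)"
    using step.hyps(1) mult_le_mono1[of 1 r "Suc (Suc k)"] assms(1) by simp
  then show ?case
    using step.IH by (simp add: right_diff_distrib fps_X_power_mult_right_nth del: mult_Suc_right)
qed simp

lemma has_prod_euler_prod:
  assumes "r > 0"
  shows "(\<lambda>m. 1 - fps_X ^ (r * Suc m)) has_prod euler_prod r"
proof -
  define P :: "int fps"
    where "P = Abs_fps (\<lambda>n. fps_nth (\<Prod>m\<le>n. 1 - fps_X ^ (r * Suc m)) n)"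
  have lim: "(\<lambda>k. \<Prod>m\<le>k. 1 - fps_X ^ (r * Suc m)) \<longlonglongrightarrow> P"
  proof (rule tendsto_fpsI)
    fix n
    show "\<forall>\<^sub>F k in sequentially.
            fps_nth (\<Prod>m\<le>k. 1 - fps_X ^ (r * Suc m)) n = fps_nth P n"
      using eventually_ge_at_top[of n]
      unfolding P_def fps_nth_Abs_fps
      by eventually_elim (rule fps_nth_euler_partial[OF assms])
  qed
  have "fps_nth P 0 = 1"
    using assms by (simp add: P_def)
  then have "P \<noteq> 0"
    by auto
  with lim have "(\<lambda>m. 1 - fps_X ^ (r * Suc m)) has_prod P"
    by (simp add: has_prod_def raw_has_prod_def)
  then show ?thesis
    unfolding euler_prod_def using has_prod_unique by metis
qed

lemma fps_nth_euler_prod: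
  assumes "r > 0"
  shows "fps_nth (euler_prod r) n = fps_nth (\<Prod>m\<le>n. 1 - fps_X ^ (r * Suc m)) n"
proof -
  have "1 - fps_X ^ (r * Suc m) \<noteq> (0 :: int fps)" for m
  proof -
    have "fps_nth (1 - fps_X ^ (r * Suc m) :: int fps) 0 = 1"
      using assms by simp
    then show ?thesis
      by (metis fps_zero_nth zero_neq_one)
  qed
  then have "(\<lambda>k. \<Prod>m\<le>k. 1 - fps_X ^ (r * Suc m)) \<longlonglongrightarrow> euler_prod r"
    using has_prod_euler_prod[OF assms] by (simp add: has_prod_def raw_has_prod_def)
  then have "\<forall>\<^sub>F k in sequentially.
      fps_nth (\<Prod>m\<le>k. 1 - fps_X ^ (r * Suc m)) n = fps_nth (euler_prod r) n"
    by (simp add: tendsto_fps_iff)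
  then obtain N where "\<And>k. k \<ge> N \<Longrightarrow>
      fps_nth (\<Prod>m\<le>k. 1 - fps_X ^ (r * Suc m)) n = fps_nth (euler_prod r) n"
    unfolding eventually_sequentially by blast
  from this[of "max n N"] show ?thesis
    using fps_nth_euler_partial[OF assms, of n "max n N"] by simp
qed

lemma colored_overpartitions_gf:
  "Abs_fps (colored_overpartitions t) * (euler_prod 1 ^ 2) ^ t = euler_prod 2 ^ t"
proof -
  have "fps_nth (euler_prod 1) 0 = 1"
    by (subst fps_nth_euler_prod) auto
  then have "euler_prod 1 ^ 2 * fps_right_inverse (euler_prod 1 ^ 2) 1 = 1"
    by (intro fps_right_inverse) (simp add: fps_nth_power_0)
  then have "euler_prod 2 * fps_right_inverse (euler_prod 1 ^ 2) 1 * euler_prod 1 ^ 2 = euler_prod 2"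
    by (metis mult.assoc mult.commute mult_1)
  then have "colored_overpartitions_gf t * (euler_prod 1 ^ 2) ^ t = euler_prod 2 ^ t"
    unfolding colored_overpartitions_gf_def power_mult_distrib[symmetric] by (rule arg_cong)
  moreover have "Abs_fps (colored_overpartitions t) = colored_overpartitions_gf t"
    by (rule fps_ext) (simp add: colored_overpartitions_def)
  ultimately show ?thesis
    by simp
qed

end

theory Submission
  imports Defs
begin

text \<open>Writing \<open>(1 - q\<^sup>2\<^sup>m) / (1 - q\<^sup>m)\<^sup>2 = 1 + 2 q\<^sup>m / (1 - q\<^sup>m)\<close> and discarding multiples of 4 in the
  product over \<open>m\<close>, one gets \<open>f\<^sub>2 / f\<^sub>1\<^sup>2 \<equiv> 1 + 2 D (mod 4)\<close>, where
  \<open>D = \<Sum>\<^sub>m q\<^sup>m / (1 - q\<^sup>m)\<close> is the Lambert series whose coefficients count divisors. Since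
  \<open>(1 + 2 D)\<^sup>2 \<equiv> 1 (mod 4)\<close>, odd powers do not change the residue, and the number of divisors of
  \<open>n\<close> is odd precisely when \<open>n\<close> is a square.\<close>

text \<open>The map \<open>d\<close> to \<open>n div d\<close> exchanges the divisors below the
  square root of \<open>n\<close> with those above it. These pair off, so the parity is decided by
  the set \<open>R\<close> of exact square roots, which has at most one element.\<close>

lemma odd_card_divisors_iff:
  fixes n :: nat
  assumes "n > 0"
  shows "odd (card {d. d dvd n}) \<longleftrightarrow> is_square n"
proof -
  define S where "S = {d. d dvd n \<and> d * d < n}"
  define L where "L = {d. d dvd n \<and> d * d > n}"
  define R where "R = {d. d * d = n}"
  have fin: "finite {d. d dvd n}"
    using assms by simp
  have finS: "finite S" and finL: "finite L" and finR: "finite R"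
    by (auto intro: finite_subset[OF _ fin] simp: S_def L_def R_def)
  have "bij_betw (\<lambda>d. n div d) S L"
  proof (rule bij_betw_byWitness[where f' = "\<lambda>d. n div d"])
    have *: "n div d * (n div d) > n" if "d * e = n" "d * d < n" for d e
    proof -
      from that assms have "d > 0" "d < e" "e > 0"
        by (auto intro: Nat.gr0I)
      then have "d * e < e * e" by simp
      with that \<open>d > 0\<close> show ?thesis by auto
    qed
    have **: "n div d * (n div d) < n" if "d * e = n" "d * d > n" for d e
    proof -
      from that assms have "d > 0" "e < d" "e > 0"
        by (auto intro: Nat.gr0I)
      then have "e * e < d * e" by simp
      with that \<open>d > 0\<close> show ?thesis by auto
    qed
    have div_dvd: "n div d dvd n" if "d dvd n" for d
      using that by (metis dvd_div_mult_self dvd_triv_left)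
    show "(\<lambda>d. n div d) ` S \<subseteq> L"
      using * div_dvd by (fastforce simp: S_def L_def dvd_def)
    show "(\<lambda>d. n div d) ` L \<subseteq> S"
      using ** div_dvd by (fastforce simp: S_def L_def dvd_def)
    show "\<forall>d\<in>S. n div (n div d) = d" "\<forall>d\<in>L. n div (n div d) = d"
      using assms by (auto simp: S_def L_def)
  qed
  then have "card S = card L"
    by (rule bij_betw_same_card)
  moreover have "{d. d dvd n} = (S \<union> L) \<union> R"
    by (auto simp: S_def L_def R_def)
  moreover have "card ((S \<union> L) \<union> R) = card (S \<union> L) + card R"
    using finS finL finR by (intro card_Un_disjoint) (auto simp: S_def L_def R_def)
  moreover have "card (S \<union> L) = card S + card L"
    using finS finL by (intro card_Un_disjoint) (auto simp: S_def L_def)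
  moreover have "card R = (if is_square n then 1 else 0)"
  proof (cases "is_square n")
    case True
    then obtain k where "n = k ^ 2"
      by (auto elim: is_nth_powerE)
    then have "R = {k}"
      by (auto simp: R_def power2_eq_square[symmetric])
    with True show ?thesis by simp
  next
    case False
    then have "R = {}"
      by (auto simp: R_def power2_eq_square[symmetric])
    with False show ?thesis by simp
  qed
  ultimately show ?thesis by simp
qed

text \<open>This allows congruences modulo 4 to be multiplied and cancelled in the ring of power
  series and then read off coefficient by coefficient.\<close>

lemma fps_numeral_dvd_iff:
  "(numeral k :: int fps) dvd F \<longleftrightarrow> (\<forall>n. numeral k dvd fps_nth F n)"
proof
  assume "(numeral k :: int fps) dvd F"
  then show "\<forall>n. numeral k dvd fps_nth F n"
    by (auto simp: numeral_fps_const elim!: dvdE)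
next
  assume *: "\<forall>n. numeral k dvd fps_nth F n"
  have "F = numeral k * Abs_fps (\<lambda>n. fps_nth F n div numeral k)"
    using * by (intro fps_ext) (simp add: numeral_fps_const)
  then show "(numeral k :: int fps) dvd F" by (metis dvd_triv_left)
qed

lemma dvd_diff_mult:
  fixes a b c d k :: "'a :: comm_ring_1"
  assumes "k dvd a - b" "k dvd c - d"
  shows "k dvd a * c - b * d"
proof -
  have "a * c - b * d = (a - b) * c + b * (c - d)"
    by (simp add: algebra_simps)
  with assms show ?thesis by simp
qed

lemma dvd_diff_power:
  fixes a b k :: "'a :: comm_ring_1"
  assumes "k dvd a - b"
  shows "k dvd a ^ t - b ^ t"
  by (induction t) (auto intro: dvd_diff_mult assms)

text \<open>For \<open>m > 0\<close> this is the expansion of q^m / (1 - q^m). The condition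
  \<open>i > 0\<close> removes the constant term, since \<open>m dvd 0\<close>.\<close>

definition geom_fps :: "nat \<Rightarrow> int fps" where
  "geom_fps m = Abs_fps (\<lambda>i. if i > 0 \<and> m dvd i then 1 else 0)"

lemma geom_fps_mult:
  assumes "m > 0"
  shows "(1 - fps_X ^ m) * geom_fps m = fps_X ^ m"
proof (rule fps_ext)
  fix i
  show "fps_nth ((1 - fps_X ^ m) * geom_fps m) i = fps_nth (fps_X ^ m) i"
    using assms
    by (auto simp: left_diff_distrib fps_X_power_mult_nth geom_fps_def
        dvd_minus_self dest: dvd_imp_le)
qed

text \<open>The factorwise identity with its denominator cleared: one factor 1 - q^m turns
  \<open>1 + 2 * geom_fps m\<close> into 1 + q^m, and the other completes a difference of
  squares.\<close>

lemma one_minus_X_power_double: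
  assumes "m > 0"
  shows "1 - fps_X ^ (2 * m) = (1 - fps_X ^ m) ^ 2 * (1 + 2 * geom_fps m)"
proof -
  have "(1 - fps_X ^ m) ^ 2 * (1 + 2 * geom_fps m) =
        (1 - fps_X ^ m) * ((1 - fps_X ^ m) + 2 * ((1 - fps_X ^ m) * geom_fps m))"
    by (simp add: power2_eq_square algebra_simps)
  also have "\<dots> = (1 - fps_X ^ m) * (1 + fps_X ^ m)"
    by (simp add: geom_fps_mult[OF assms])
  also have "\<dots> = 1 - fps_X ^ m * fps_X ^ m"
    by (simp add: algebra_simps)
  also have "\<dots> = 1 - fps_X ^ (2 * m)"
    by (simp only: power_add mult_2)
  finally show ?thesis by simp
qed

lemma four_dvd_prod_one_plus_double:
  fixes g :: "'b \<Rightarrow> 'a :: comm_ring_1"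
  assumes "finite A"
  shows "4 dvd (\<Prod>x\<in>A. 1 + 2 * g x) - (1 + 2 * (\<Sum>x\<in>A. g x))"
  using assms
proof (induction A rule: finite_induct)
  case (insert x A)
  let ?s = "\<Sum>x\<in>A. g x"
  have "4 dvd (1 + 2 * g x) * (\<Prod>x\<in>A. 1 + 2 * g x) - (1 + 2 * g x) * (1 + 2 * ?s)"
    by (rule dvd_diff_mult) (simp_all add: insert.IH)
  \<comment> \<open>This is the cross term of (1 + 2 g x)(1 + 2 s), the only part that the linear
    expression omits.\<close>
  moreover have "(4 :: 'a) dvd 4 * (g x * ?s)"
    by simp
  ultimately have "4 dvd ((1 + 2 * g x) * (\<Prod>x\<in>A. 1 + 2 * g x) - (1 + 2 * g x) * (1 + 2 * ?s))
      + 4 * (g x * ?s)"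
    by (rule dvd_add)
  with insert.hyps show ?case
    by (simp add: algebra_simps)
qed simp

text \<open>A convolution up to index \<open>n\<close> sees only coefficients up to
  \<open>n\<close>, so truncations may replace infinite products inside a product.\<close>

lemma fps_mult_nth_cong:
  assumes "\<And>i. i \<le> n \<Longrightarrow> fps_nth F i = fps_nth F' i"
    and "\<And>i. i \<le> n \<Longrightarrow> fps_nth G i = fps_nth G' i"
    and "j \<le> n"
  shows "fps_nth (F * G) j = fps_nth (F' * G') j"
  using assms by (simp add: fps_mult_nth)

definition divisor_fps :: "int fps" where
  "divisor_fps = Abs_fps (\<lambda>n. if n = 0 then 0 else int (card {d. d dvd n}))"

text \<open>The term for \<open>m\<close> contributes 1 exactly when \<open>Suc m\<close> divides
  \<open>i\<close>. The cutoff loses nothing, because a divisor of a positive \<open>i\<close> is at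
  most \<open>i\<close>.\<close>

lemma fps_nth_sum_geom_fps:
  assumes "i \<le> n"
  shows "fps_nth (\<Sum>m\<le>n. geom_fps (Suc m)) i = fps_nth divisor_fps i"
proof (cases "i = 0")
  case False
  have "fps_nth (\<Sum>m\<le>n. geom_fps (Suc m)) i = (\<Sum>m\<le>n. if Suc m dvd i then 1 else 0)"
    using False by (simp add: fps_sum_nth geom_fps_def)
  also have "\<dots> = int (card {m \<in> {..n}. Suc m dvd i})"
    by (simp add: sum.If_cases Int_def)
  also have "card {m \<in> {..n}. Suc m dvd i} = card (Suc ` {m \<in> {..n}. Suc m dvd i})"
    by (simp add: card_image)
  also have "Suc ` {m \<in> {..n}. Suc m dvd i} = {d. d dvd i}"
  proof (intro equalityI subsetI)
    fix d assume "d \<in> {d. d dvd i}"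
    with False have "d dvd i" "d > 0" "d \<le> i"
      by (auto intro: Nat.gr0I dest: dvd_imp_le)
    with assms have "d = Suc (d - 1)" "d - 1 \<in> {m \<in> {..n}. Suc m dvd i}"
      by auto
    then show "d \<in> Suc ` {m \<in> {..n}. Suc m dvd i}"
      by (rule image_eqI)
  qed auto
  finally show ?thesis
    using False by (simp add: divisor_fps_def)
qed (simp add: fps_sum_nth geom_fps_def divisor_fps_def)

lemma four_dvd_euler_prod_2:
  "4 dvd euler_prod 2 - euler_prod 1 ^ 2 * (1 + 2 * divisor_fps)"
  unfolding fps_numeral_dvd_iff
proof
  fix n
  define A where "A = (\<Prod>m\<le>n. 1 - fps_X ^ Suc m :: int fps)"
  define B where "B = (\<Prod>m\<le>n. 1 - fps_X ^ (2 * Suc m) :: int fps)"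
  define G where "G = (\<Sum>m\<le>n. geom_fps (Suc m))"
  \<comment> \<open>\<open>A\<close> enters a convolution, so all its coefficients up to
    \<open>n\<close> must be correct; for \<open>B\<close> the coefficient at \<open>n\<close>
    suffices.\<close>
  have A: "fps_nth A i = fps_nth (euler_prod 1) i" if "i \<le> n" for i
    using fps_nth_euler_partial[of 1 i n] fps_nth_euler_prod[of 1 i] that by (simp add: A_def)
  have B: "fps_nth B n = fps_nth (euler_prod 2) n"
    using fps_nth_euler_prod[of 2 n] unfolding B_def by simp
  have "fps_nth (A ^ 2 * (1 + 2 * G)) n = fps_nth (euler_prod 1 ^ 2 * (1 + 2 * divisor_fps)) n"
    unfolding power2_eq_square
    by (intro fps_mult_nth_cong[of n] A)
      (simp_all add: G_def fps_nth_sum_geom_fps numeral_fps_const)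
  moreover have "B = A ^ 2 * (\<Prod>m\<le>n. 1 + 2 * geom_fps (Suc m))"
    unfolding B_def A_def
    by (subst one_minus_X_power_double) (simp_all add: prod.distrib prod_power_distrib)
  then have "4 dvd B - A ^ 2 * (1 + 2 * G)"
    using four_dvd_prod_one_plus_double[of "{..n}" "\<lambda>m. geom_fps (Suc m)"]
    by (auto simp: G_def intro!: dvd_diff_mult)
  then have "4 dvd fps_nth (B - A ^ 2 * (1 + 2 * G)) n"
    unfolding fps_numeral_dvd_iff by blast
  ultimately show "4 dvd fps_nth (euler_prod 2 - euler_prod 1 ^ 2 * (1 + 2 * divisor_fps)) n"
    using B by simp
qed

text \<open>The square of 1 + 2 x is 1 + 4 (x + x^2), so a single factor of the odd power survives
  modulo 4.\<close>

lemma four_dvd_odd_power_one_plus_double: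
  fixes x :: "'a :: comm_ring_1"
  assumes "odd t"
  shows "4 dvd (1 + 2 * x) ^ t - (1 + 2 * x)"
proof -
  obtain s where t: "t = Suc (2 * s)"
    using assms by (auto elim: oddE)
  have "(1 + 2 * x) ^ 2 - 1 = 4 * (x + x ^ 2)"
    by (simp add: power2_eq_square algebra_simps)
  then have "4 dvd (1 + 2 * x) ^ 2 - 1"
    by simp
  then have "4 dvd ((1 + 2 * x) ^ 2) ^ s - 1 ^ s"
    by (rule dvd_diff_power)
  then have "4 dvd (1 + 2 * x) * ((1 + 2 * x) ^ 2) ^ s - (1 + 2 * x) * 1"
    by (intro dvd_diff_mult) simp_all
  then show ?thesis
    by (simp add: t power_mult)
qed

lemma four_dvd_colored_overpartitions:
  assumes "odd t"
  shows "4 dvd Abs_fps (colored_overpartitions t) - (1 + 2 * divisor_fps)"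
proof -
  let ?C = "Abs_fps (colored_overpartitions t)" and ?E = "(euler_prod 1 ^ 2) ^ t"
  let ?D = "1 + 2 * divisor_fps"
  have "fps_nth (euler_prod 1) 0 = 1"
    by (subst fps_nth_euler_prod) auto
  \<comment> \<open>With constant coefficient 1, \<open>?E\<close> is a unit over the integers and
    can be cancelled from a divisibility by 4.\<close>
  then have inv: "?E * fps_right_inverse ?E 1 = 1"
    by (intro fps_right_inverse) (simp add: fps_nth_power_0)
  have "4 dvd euler_prod 2 ^ t - (euler_prod 1 ^ 2 * ?D) ^ t"
    by (intro dvd_diff_power four_dvd_euler_prod_2)
  also have "euler_prod 2 ^ t - (euler_prod 1 ^ 2 * ?D) ^ t = ?E * (?C - ?D ^ t)"
    unfolding colored_overpartitions_gf[symmetric] power_mult_distrib[of _ ?D]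
    by (simp only: right_diff_distrib mult.commute)
  finally have "4 dvd fps_right_inverse ?E 1 * (?E * (?C - ?D ^ t))"
    by (rule dvd_mult)
  also have "\<dots> = ?E * fps_right_inverse ?E 1 * (?C - ?D ^ t)"
    by (simp only: mult_ac)
  finally have "4 dvd ?C - ?D ^ t"
    unfolding inv by simp
  from dvd_add[OF this four_dvd_odd_power_one_plus_double[OF assms, of divisor_fps]]
  show ?thesis by (simp only: add_diff_eq diff_add_cancel)
qed

theorem theorem3p2:
  fixes t n :: nat
  assumes "odd t"
  shows "[colored_overpartitions t n =
          (if n = 0 then 1 else if is_square n then 2 else 0)] (mod 4)"
proof -
  have "4 dvd fps_nth (Abs_fps (colored_overpartitions t) - (1 + 2 * divisor_fps)) n"
    using four_dvd_colored_overpartitions[OF assms] unfolding fps_numeral_dvd_iff by blast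
  then have *: "4 dvd colored_overpartitions t n -
      (if n = 0 then 1 else 2 * int (card {d. d dvd n}))"
    by (simp add: divisor_fps_def numeral_fps_const split: if_splits)
  show ?thesis
  proof (cases "n = 0")
    case True
    with * show ?thesis by (simp add: cong_iff_dvd_diff)
  next
    case False
    \<comment> \<open>Modulo 4, twice the number of divisors depends only on the parity of that
      number.\<close>
    then have "odd (card {d. d dvd n}) \<longleftrightarrow> is_square n"
      by (intro odd_card_divisors_iff) simp
    with False * show ?thesis
      unfolding cong_iff_dvd_diff by (cases "is_square n") (simp; presburger)+
  qed
qed

end
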